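(* For any triangle $\vec z=(z_1,z_2,z_3)\in\mathbb C^3$ on the complex plane, 1. the isometric deviation of $\vec z$ from $\triangle$ is $$d(\mathbb T\vec z+\mathbb C,\triangle)=\sqrt{1+u^2-\sqrt2\,u\sqrt{1+\operatorname{sign}(\vec z)\sqrt{3-6q}}};$$ 2. the affine deviation of $\vec z$ from $\triangle$ is $$d(\mathbb C^*\vec z+\mathbb C,\triangle)=\sqrt{\tfrac12\big(1-\operatorname{sign}(\vec z)\sqrt{3-6q}\,\big)},$$ where $$u=\sqrt{\frac{|z_1-z_2|^2+|z_2-z_3|^2+|z_3-z_1|^2}{3}}\quad\text{and}\quad q=\frac{|z_1-z_2|^4+|z_2-z_3|^4+|z_3-z_1|^4}{\big(|z_1-z_2|^2+|z_2-z_3|^2+|z_3-z_1|^2\big)^2},$$ with the convention $q=\frac12$ if $z_1=z_2=z_3$.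
   Context: $\mathbb T=\{z\in\mathbb C:|z|=1\}$, $\mathbb C^*=\mathbb C\setminus\{0\}$. For $\vec x,\vec y\in\mathbb C^n$, $d(\vec x,\vec y)=\big(\sum_{k=1}^n|x_k-y_k|^2\big)^{1/2}$; for $a,b\in\mathbb C$, $a\vec x+b=(ax_1+b,\dots,ax_n+b)$. The isometric deviation of $\vec x$ from $\vec y$ is $d(\mathbb T\vec x+\mathbb C,\vec y)=\inf\{d(a\vec x+b,\vec y):a\in\mathbb T,\ b\in\mathbb C\}$ and the affine deviation is $d(\mathbb C^*\vec x+\mathbb C,\vec y)=\inf\{d(a\vec x+b,\vec y):a\in\mathbb C^*,\ b\in\mathbb C\}$. $\triangle=\frac1{\sqrt3}\big(1,e^{i2\pi/3},e^{-i2\pi/3}\big)\in\mathbb C^3$ is the model regular triangle with sides of length 1. A triangle is any triple $\vec z=(z_1,z_2,z_3)$ of points of $\mathbb C$ (degenerate ones allowed). It is singular if $z_1=z_2=z_3$, and linear if there are pairwise distinct $i,j,k\in\{1,2,3\}$ with $|z_i-z_k|=|z_i-z_j|+|z_j-z_k|$. The orientation $\operatorname{sign}(\vec z)$ equals $-1$ if $\vec z$ is singular; $0$ if $\vec z$ is linear and not singular; $1$ if $\vec z$ is non-linear and oriented counter-clockwise; $-1$ if $\vec z$ is non-linear and oriented clockwise.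
   Formalization: Part 2 is proved with the printed formula for all non-singular triangles; for z_1=z_2=z_3 the printed formula (q=1/2, sign=-1) gives sqrt(1/2), which is false, and the true affine deviation 1 is stated and proved instead. *)

theory Defs
  imports "HOL-Analysis.Analysis"
begin

text \<open>
  On \<open>complex ^ 'n\<close> the library distance \<^const>\<open>dist\<close> is the Euclidean distance
  \<open>sqrt (\<Sum>k. (cmod (x $ k - y $ k))\<^sup>2)\<close>, and \<open>a *s x + vec b\<close> is the vector with
  coordinates \<open>a * x $ k + b\<close>.
\<close>

definition isometric_deviation :: "complex ^ 'n \<Rightarrow> complex ^ 'n \<Rightarrow> real" where
  "isometric_deviation x y = Inf {dist (a *s x + vec b) y | a b. cmod a = 1}"

definition affine_deviation :: "complex ^ 'n \<Rightarrow> complex ^ 'n \<Rightarrow> real" where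
  "affine_deviation x y = Inf {dist (a *s x + vec b) y | a b. a \<noteq> 0}"

definition model_triangle :: "complex ^ 3" where
  "model_triangle = (1 / sqrt 3) *\<^sub>R vector [1, cis (2 * pi / 3), cis (- (2 * pi / 3))]"

definition singular_triangle :: "complex ^ 3 \<Rightarrow> bool" where
  "singular_triangle z \<longleftrightarrow> z $ 1 = z $ 2 \<and> z $ 2 = z $ 3"

definition linear_triangle :: "complex ^ 3 \<Rightarrow> bool" where
  "linear_triangle z \<longleftrightarrow>
     (\<exists>i j k. i \<noteq> j \<and> j \<noteq> k \<and> i \<noteq> k \<and>
        cmod (z $ i - z $ k) = cmod (z $ i - z $ j) + cmod (z $ j - z $ k))"

text \<open>The imaginary part below is twice the signed area of the triangle.\<close>

definition counterclockwise :: "complex ^ 3 \<Rightarrow> bool" where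
  "counterclockwise z \<longleftrightarrow> Im (cnj (z $ 2 - z $ 1) * (z $ 3 - z $ 1)) > 0"

definition orientation_sign :: "complex ^ 3 \<Rightarrow> real" where
  "orientation_sign z =
     (if singular_triangle z then -1
      else if linear_triangle z then 0
      else if counterclockwise z then 1
      else -1)"

definition side_u :: "complex ^ 3 \<Rightarrow> real" where
  "side_u z = sqrt (((cmod (z $ 1 - z $ 2))^2 + (cmod (z $ 2 - z $ 3))^2
                     + (cmod (z $ 3 - z $ 1))^2) / 3)"

definition shape_q :: "complex ^ 3 \<Rightarrow> real" where
  "shape_q z =
     (if singular_triangle z then 1 / 2
      else ((cmod (z $ 1 - z $ 2))^4 + (cmod (z $ 2 - z $ 3))^4 + (cmod (z $ 3 - z $ 1))^4)
           / ((cmod (z $ 1 - z $ 2))^2 + (cmod (z $ 2 - z $ 3))^2 + (cmod (z $ 3 - z $ 1))^2)^2)"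

text \<open>
  The value \<open>1 / 2\<close> of \<^const>\<open>shape_q\<close> at singular triangles is immaterial in the formula for the
  isometric deviation, where \<open>side_u z = 0\<close>. In the formula for the affine deviation it would give
  \<open>sqrt (1 / 2)\<close>, whereas the affine deviation of a singular triangle from
  \<^const>\<open>model_triangle\<close> is \<open>1\<close>: all triangles \<open>a *s z + vec b\<close> are then constant, and
  \<^const>\<open>model_triangle\<close> has norm 1 and is orthogonal to the constant ones. So that formula has to
  be stated for non-singular triangles, with the value \<open>1\<close> at singular ones.
\<close>

end

theory Submission
  imports Defs
begin

text \<open>
  Translations act only along the constant vectors, so for a centred target \<open>y\<close> (one whose
  coordinates sum to 0) the best \<open>b\<close> moves \<open>a *s x\<close> to its centred version. What remains is the
  quadratic function \<open>(cmod a)\<^sup>2 * V - 2 * Re (a * C) + (norm y)\<^sup>2\<close> of \<open>a\<close>, in which \<open>V\<close> is the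
  squared norm of the centred \<open>x\<close> and \<open>C\<close> is the Hermitian product of \<open>x\<close> and \<open>y\<close>. On the unit
  circle its minimum is at \<open>a = cnj C / cmod C\<close>, and on the whole plane at \<open>a = cnj C / V\<close>
  (lemmas \<open>isometric_deviation_centred\<close> and \<open>affine_deviation_centred\<close>).

  For the model triangle \<open>V = u\<^sup>2\<close>, and expanding \<open>C\<close>, which is a Fourier coefficient of \<open>z\<close> with
  respect to the cube roots of unity, gives \<open>(cmod C)\<^sup>2 = u\<^sup>2 / 2 + Y / sqrt 3\<close>, where \<open>Y\<close> is
  twice the signed area. Heron's formula expresses \<open>4 * Y\<^sup>2\<close> through the side lengths, which turns
  \<open>sqrt (3 - 6 * q)\<close> into a multiple of \<open>\<bar>Y\<bar>\<close>. It also shows that \<open>Y\<close> vanishes exactly for linear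
  triangles, so that the orientation of a non-singular triangle is the sign of \<open>Y\<close>, and
  \<open>2 * (cmod C)\<^sup>2 = u\<^sup>2 * (1 + sign * sqrt (3 - 6 * q))\<close>.
\<close>

section \<open>Deviation from a centred vector\<close>

definition centroid :: "complex ^ 'n \<Rightarrow> complex" where
  "centroid x = (\<Sum>k\<in>UNIV. x $ k) / of_nat CARD('n)"

definition dispersion :: "complex ^ 'n \<Rightarrow> real" where
  "dispersion x = (\<Sum>k\<in>UNIV. (cmod (x $ k - centroid x))\<^sup>2)"

definition hermitian_product :: "complex ^ 'n \<Rightarrow> complex ^ 'n \<Rightarrow> complex" where
  "hermitian_product x y = (\<Sum>k\<in>UNIV. x $ k * cnj (y $ k))"

lemma sum_centred: "(\<Sum>k\<in>UNIV. x $ k - centroid x) = 0" for x :: "complex ^ 'n"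
  by (simp add: sum_subtractf centroid_def)

lemma norm_power2_eq_sum: "(norm y)\<^sup>2 = (\<Sum>k\<in>UNIV. (cmod (y $ k))\<^sup>2)"
  for y :: "complex ^ 'n"
  by (simp add: norm_vec_def L2_set_def sum_nonneg)

lemma cmod_power2_add_diff:
  "(cmod (p + q - r))\<^sup>2 = (cmod p)\<^sup>2 + (cmod q)\<^sup>2 + (cmod r)\<^sup>2
     + 2 * Re (p * cnj q) - 2 * Re (p * cnj r) - 2 * Re (q * cnj r)"
  unfolding cmod_power2 by (simp add: power2_eq_square algebra_simps)

text \<open>The constant vectors, the centred part of \<open>x\<close> and the centred \<open>y\<close> interact only through
  the Hermitian product: the other two cross terms are sums of centred coordinates.\<close>

lemma dist_affine_image_power2:
  fixes x y :: "complex ^ 'n"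
  assumes y: "(\<Sum>k\<in>UNIV. y $ k) = 0"
  shows "(dist (a *s x + vec b) y)\<^sup>2 =
           CARD('n) * (cmod (b + a * centroid x))\<^sup>2
           + (cmod a)\<^sup>2 * dispersion x - 2 * Re (a * hermitian_product x y) + (norm y)\<^sup>2"
proof -
  define m where "m = centroid x"
  define t where "t = b + a * m"
  define w where "w k = x $ k - m" for k
  have w: "(\<Sum>k\<in>UNIV. w k) = 0"
    unfolding w_def m_def by (rule sum_centred)
  have wy: "(\<Sum>k\<in>UNIV. w k * cnj (y $ k)) = hermitian_product x y"
    using arg_cong[OF y, of cnj]
    by (simp add: w_def hermitian_product_def left_diff_distrib sum_subtractf
        flip: sum_distrib_left cnj_sum)
  have aw: "(\<Sum>k\<in>UNIV. Re (a * w k * cnj t)) = 0"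
    unfolding Re_sum[symmetric] sum_distrib_right[symmetric] sum_distrib_left[symmetric] w by simp
  have awy: "(\<Sum>k\<in>UNIV. Re (a * w k * cnj (y $ k))) = Re (a * hermitian_product x y)"
    unfolding Re_sum[symmetric] mult.assoc sum_distrib_left[symmetric] wy ..
  have ty: "(\<Sum>k\<in>UNIV. Re (t * cnj (y $ k))) = 0"
    unfolding Re_sum[symmetric] sum_distrib_left[symmetric] cnj_sum[symmetric] y by simp
  have "(dist (a *s x + vec b) y)\<^sup>2 = (\<Sum>k\<in>UNIV. (cmod (a * w k + t - y $ k))\<^sup>2)"
    by (simp add: dist_norm norm_power2_eq_sum w_def t_def algebra_simps)
  also have "\<dots> = (\<Sum>k\<in>UNIV. (cmod (a * w k))\<^sup>2) + CARD('n) * (cmod t)\<^sup>2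
      + (\<Sum>k\<in>UNIV. (cmod (y $ k))\<^sup>2) + 2 * (\<Sum>k\<in>UNIV. Re (a * w k * cnj t))
      - 2 * (\<Sum>k\<in>UNIV. Re (a * w k * cnj (y $ k))) - 2 * (\<Sum>k\<in>UNIV. Re (t * cnj (y $ k)))"
    unfolding cmod_power2_add_diff by (simp add: sum.distrib sum_subtractf sum_distrib_left)
  also have "(\<Sum>k\<in>UNIV. (cmod (a * w k))\<^sup>2) = (cmod a)\<^sup>2 * dispersion x"
    by (simp add: dispersion_def w_def m_def norm_mult power_mult_distrib sum_distrib_left)
  finally show ?thesis
    unfolding aw awy ty by (simp add: t_def m_def norm_power2_eq_sum)
qed

lemma dist_affine_image_ge:
  fixes x y :: "complex ^ 'n"
  assumes "(\<Sum>k\<in>UNIV. y $ k) = 0"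
  shows "sqrt ((cmod a)\<^sup>2 * dispersion x - 2 * Re (a * hermitian_product x y) + (norm y)\<^sup>2)
           \<le> dist (a *s x + vec b) y"
  by (rule real_le_lsqrt) (simp_all add: dist_affine_image_power2[OF assms])

lemma dist_recentred_image:
  fixes x y :: "complex ^ 'n"
  assumes "(\<Sum>k\<in>UNIV. y $ k) = 0"
  shows "dist (a *s x + vec (- a * centroid x)) y =
           sqrt ((cmod a)\<^sup>2 * dispersion x - 2 * Re (a * hermitian_product x y) + (norm y)\<^sup>2)"
  by (rule real_sqrt_unique[symmetric]) (simp_all add: dist_affine_image_power2[OF assms])

theorem isometric_deviation_centred:
  fixes x y :: "complex ^ 'n"
  assumes y: "(\<Sum>k\<in>UNIV. y $ k) = 0"
  shows "isometric_deviation x y =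
           sqrt (dispersion x - 2 * cmod (hermitian_product x y) + (norm y)\<^sup>2)"
proof -
  define C where "C = hermitian_product x y"
  \<comment> \<open>The rotation that makes \<open>a * C\<close> a nonnegative real; for \<open>C = 0\<close> every rotation does.\<close>
  define a where "a = (if C = 0 then 1 else cnj C / cmod C)"
  have a: "cmod a = 1" "a * C = cmod C"
    by (auto simp: a_def norm_divide complex_norm_square[symmetric] power2_eq_square
        mult.commute[of "cnj C"])
  have attained: "dist (a *s x + vec (- a * centroid x)) y =
      sqrt (dispersion x - 2 * cmod C + (norm y)\<^sup>2)"
    unfolding dist_recentred_image[OF y] C_def[symmetric] a by simp
  show ?thesis
    unfolding isometric_deviation_def C_def[symmetric]
  proof (rule cInf_eq_minimum)
    show "sqrt (dispersion x - 2 * cmod C + (norm y)\<^sup>2)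
            \<in> {dist (a *s x + vec b) y |a b. cmod a = 1}"
      using attained[symmetric] a(1) by blast
  next
    fix d assume "d \<in> {dist (a *s x + vec b) y |a b. cmod a = 1}"
    then obtain a b where d: "d = dist (a *s x + vec b) y" "cmod a = 1"
      by blast
    have "Re (a * C) \<le> cmod C"
      using complex_Re_le_cmod[of "a * C"] d(2) by (simp add: norm_mult)
    then have "sqrt (dispersion x - 2 * cmod C + (norm y)\<^sup>2)
        \<le> sqrt ((cmod a)\<^sup>2 * dispersion x - 2 * Re (a * C) + (norm y)\<^sup>2)"
      using d(2) by simp
    also have "\<dots> \<le> d"
      using dist_affine_image_ge[OF y] d(1) by (simp add: C_def)
    finally show "sqrt (dispersion x - 2 * cmod C + (norm y)\<^sup>2) \<le> d" .
  qed
qed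

lemma dispersion_completed_square:
  assumes "V > 0"
  shows "(cmod a)\<^sup>2 * V - 2 * Re (a * C) =
           V * (cmod (a - cnj C / of_real V))\<^sup>2 - (cmod C)\<^sup>2 / V"
  using assms unfolding cmod_power2 by (simp add: field_simps power2_eq_square)

text \<open>When \<open>x\<close> and \<open>y\<close> are orthogonal the minimizing factor is 0, which is not an admissible one,
  and the infimum is not attained. Admissible factors are dense, so a lower bound for them
  nevertheless holds at the minimizing factor.\<close>

theorem affine_deviation_centred:
  fixes x y :: "complex ^ 'n"
  assumes y: "(\<Sum>k\<in>UNIV. y $ k) = 0" and V: "dispersion x > 0"
  shows "affine_deviation x y =
           sqrt ((norm y)\<^sup>2 - (cmod (hermitian_product x y))\<^sup>2 / dispersion x)"
proof -
  define C where "C = hermitian_product x y"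
  define a0 where "a0 = cnj C / of_real (dispersion x)"
  define f where "f a = sqrt ((cmod a)\<^sup>2 * dispersion x - 2 * Re (a * C) + (norm y)\<^sup>2)" for a
  have f: "f a = sqrt (dispersion x * (cmod (a - a0))\<^sup>2 - (cmod C)\<^sup>2 / dispersion x + (norm y)\<^sup>2)" for a
    unfolding f_def a0_def dispersion_completed_square[OF V] ..
  have f_min: "f a0 \<le> f a" for a
    unfolding f using V by simp
  have f_ge: "f a \<le> dist (a *s x + vec b) y" for a b
    using dist_affine_image_ge[OF y] by (simp add: f_def C_def)
  have f_eq: "dist (a *s x + vec (- a * centroid x)) y = f a" for a
    using dist_recentred_image[OF y] by (simp add: f_def C_def)
  have "affine_deviation x y = f a0"
    unfolding affine_deviation_def
  proof (rule cInf_eq_non_empty)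
    show "{dist (a *s x + vec b) y |a b. a \<noteq> 0} \<noteq> {}"
      by (auto intro: exI[of _ 1])
  next
    fix d assume "d \<in> {dist (a *s x + vec b) y |a b. a \<noteq> 0}"
    then show "f a0 \<le> d"
      using f_min f_ge order_trans by blast
  next
    fix t assume t: "\<And>d. d \<in> {dist (a *s x + vec b) y |a b. a \<noteq> 0} \<Longrightarrow> t \<le> d"
    have sub: "- {0} \<subseteq> {a. t \<le> f a}"
    proof
      fix a :: complex assume "a \<in> - {0}"
      then have "t \<le> dist (a *s x + vec (- a * centroid x)) y"
        by (intro t) blast
      then show "a \<in> {a. t \<le> f a}"
        unfolding f_eq by simp
    qed
    have "closed {a. t \<le> f a}"
      unfolding f_def by (intro closed_Collect_le continuous_intros)
    then have "closure (- {0 :: complex}) \<subseteq> {a. t \<le> f a}"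
      using sub by (intro closure_minimal)
    then show "t \<le> f a0"
      by (auto simp: closure_complement)
  qed
  then show ?thesis
    by (simp add: f C_def)
qed

lemma affine_deviation_constant:
  fixes x y :: "complex ^ 'n"
  assumes y: "(\<Sum>k\<in>UNIV. y $ k) = 0" and x: "\<And>k. x $ k = c"
  shows "affine_deviation x y = norm y"
proof -
  have V: "dispersion x = 0"
    by (simp add: dispersion_def centroid_def x)
  have C: "hermitian_product x y = 0"
    using y by (simp add: hermitian_product_def x flip: sum_distrib_left cnj_sum)
  have ge: "norm y \<le> dist (a *s x + vec b) y" for a b
    using dist_affine_image_ge[OF y, of a x b] V C by simp
  have eq: "dist (1 *s x + vec (- 1 * centroid x)) y = norm y"
    using dist_recentred_image[OF y, of 1 x] V C by simp
  show ?thesis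
    unfolding affine_deviation_def
  proof (rule cInf_eq_minimum)
    show "norm y \<in> {dist (a *s x + vec b) y |a b. a \<noteq> 0}"
      using eq[symmetric] zero_neq_one[symmetric] by blast
  qed (use ge in blast)
qed

section \<open>Area and side lengths of a triangle\<close>

definition twice_signed_area :: "complex ^ 3 \<Rightarrow> real" where
  "twice_signed_area z = Im (cnj (z $ 2 - z $ 1) * (z $ 3 - z $ 1))"

text \<open>Heron's formula, first in the squared side lengths, where it is a polynomial identity in the
  coordinates, and then in its factored form.\<close>

lemma heron_squares:
  fixes z :: "complex ^ 3"
  defines "a \<equiv> cmod (z $ 1 - z $ 2)" and "b \<equiv> cmod (z $ 2 - z $ 3)" and "c \<equiv> cmod (z $ 3 - z $ 1)"
  shows "(a\<^sup>2 + b\<^sup>2 + c\<^sup>2)\<^sup>2 - 2 * (a ^ 4 + b ^ 4 + c ^ 4) = 4 * (twice_signed_area z)\<^sup>2"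
proof -
  have four: "t ^ 4 = (t\<^sup>2)\<^sup>2" for t :: real
    by simp
  show ?thesis
    unfolding four a_def b_def c_def cmod_power2 twice_signed_area_def
    by (simp add: algebra_simps power2_eq_square)
qed

lemma heron:
  fixes z :: "complex ^ 3"
  defines "a \<equiv> cmod (z $ 1 - z $ 2)" and "b \<equiv> cmod (z $ 2 - z $ 3)" and "c \<equiv> cmod (z $ 3 - z $ 1)"
  shows "(a + b + c) * (b + c - a) * (c + a - b) * (a + b - c) = 4 * (twice_signed_area z)\<^sup>2"
  unfolding heron_squares[symmetric] a_def[symmetric] b_def[symmetric] c_def[symmetric]
  by algebra

lemma linear_triangle_iff_sides:
  "linear_triangle z \<longleftrightarrow>
     cmod (z $ 1 - z $ 2) = cmod (z $ 2 - z $ 3) + cmod (z $ 3 - z $ 1) \<or>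
     cmod (z $ 2 - z $ 3) = cmod (z $ 3 - z $ 1) + cmod (z $ 1 - z $ 2) \<or>
     cmod (z $ 3 - z $ 1) = cmod (z $ 1 - z $ 2) + cmod (z $ 2 - z $ 3)"
proof -
  have ex_3: "(\<exists>i. P i) \<longleftrightarrow> P 1 \<or> P 2 \<or> P 3" for P :: "3 \<Rightarrow> bool"
    using forall_3[of "\<lambda>i. \<not> P i"] by blast
  show ?thesis
    unfolding linear_triangle_def ex_3 by (auto simp: norm_minus_commute)
qed

text \<open>The factors in Heron's formula vanish exactly in the degenerate cases of the triangle
  inequality. The perimeter vanishes only with all three sides, and then the other factors vanish
  as well.\<close>

lemma linear_triangle_iff_area: "linear_triangle z \<longleftrightarrow> twice_signed_area z = 0"
proof -
  define a where "a = cmod (z $ 1 - z $ 2)"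
  define b where "b = cmod (z $ 2 - z $ 3)"
  define c where "c = cmod (z $ 3 - z $ 1)"
  have nonneg: "a \<ge> 0" "b \<ge> 0" "c \<ge> 0"
    by (simp_all add: a_def b_def c_def)
  have "twice_signed_area z = 0 \<longleftrightarrow>
          (a + b + c) * (b + c - a) * (c + a - b) * (a + b - c) = 0"
    using heron[of z] by (simp add: a_def b_def c_def)
  also have "\<dots> \<longleftrightarrow> a = b + c \<or> b = c + a \<or> c = a + b"
    using nonneg by auto
  also have "\<dots> \<longleftrightarrow> linear_triangle z"
    unfolding linear_triangle_iff_sides a_def b_def c_def ..
  finally show ?thesis ..
qed

lemma orientation_sign_eq_sgn:
  assumes "\<not> singular_triangle z"
  shows "orientation_sign z = sgn (twice_signed_area z)"
  using assms linear_triangle_iff_area[of z]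
  by (auto simp: orientation_sign_def counterclockwise_def twice_signed_area_def sgn_if)

lemma side_u_power2:
  "(side_u z)\<^sup>2 = ((cmod (z $ 1 - z $ 2))\<^sup>2 + (cmod (z $ 2 - z $ 3))\<^sup>2
                   + (cmod (z $ 3 - z $ 1))\<^sup>2) / 3"
  by (simp add: side_u_def)

lemma side_u_eq_0_iff: "side_u z = 0 \<longleftrightarrow> singular_triangle z"
  by (auto simp: side_u_def singular_triangle_def add_nonneg_eq_0_iff)

text \<open>With \<open>S\<close> the sum of the squared sides, Heron's formula says
  \<open>3 - 6 * q = 3 * (2 * Y / S)\<^sup>2\<close>. The square root loses the sign of \<open>Y\<close> and the orientation
  restores it.\<close>

lemma orientation_times_shape:
  "(side_u z)\<^sup>2 * (orientation_sign z * sqrt (3 - 6 * shape_q z)) =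
     2 * twice_signed_area z / sqrt 3"
proof (cases "singular_triangle z")
  case True
  then show ?thesis
    using side_u_eq_0_iff[of z] by (simp add: singular_triangle_def twice_signed_area_def)
next
  case False
  define S where "S = (cmod (z $ 1 - z $ 2))\<^sup>2 + (cmod (z $ 2 - z $ 3))\<^sup>2 + (cmod (z $ 3 - z $ 1))\<^sup>2"
  define Q where "Q = cmod (z $ 1 - z $ 2) ^ 4 + cmod (z $ 2 - z $ 3) ^ 4 + cmod (z $ 3 - z $ 1) ^ 4"
  define Y where "Y = twice_signed_area z"
  have u: "(side_u z)\<^sup>2 = S / 3"
    by (simp add: side_u_power2 S_def)
  have S: "S > 0"
  proof -
    have "(side_u z)\<^sup>2 > 0"
      using False side_u_eq_0_iff[of z] by simp
    then show ?thesis
      unfolding u by simp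
  qed
  have Q: "2 * Q = S\<^sup>2 - 4 * Y\<^sup>2"
    using heron_squares[of z] by (simp add: S_def Q_def Y_def)
  have "3 - 6 * shape_q z = 3 - 3 * (2 * Q) / S\<^sup>2"
    using False by (simp add: shape_q_def S_def Q_def)
  also have "\<dots> = 3 * (2 * Y / S)\<^sup>2"
    unfolding Q using S by (simp add: field_simps)
  finally have "sqrt (3 - 6 * shape_q z) = sqrt 3 * (2 * \<bar>Y\<bar> / S)"
    using S by (simp add: real_sqrt_mult)
  then have "(side_u z)\<^sup>2 * (orientation_sign z * sqrt (3 - 6 * shape_q z)) =
      2 * (sgn Y * \<bar>Y\<bar>) * (sqrt 3 / 3)"
    unfolding u orientation_sign_eq_sgn[OF False] Y_def[symmetric]
    using S by (simp add: field_simps)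
  also have "\<dots> = 2 * Y / sqrt 3"
    unfolding sgn_mult_abs by (simp add: real_div_sqrt field_simps)
  finally show ?thesis
    by (simp add: Y_def)
qed

section \<open>Comparison with the model triangle\<close>

lemma model_triangle_coordinates:
  "model_triangle $ 1 = Complex (1 / sqrt 3) 0"
  "model_triangle $ 2 = Complex (- 1 / (2 * sqrt 3)) (1 / 2)"
  "model_triangle $ 3 = Complex (- 1 / (2 * sqrt 3)) (- 1 / 2)"
  by (simp_all add: model_triangle_def complex_eq_iff cos_120 sin_120)

lemma model_triangle_centred: "(\<Sum>k\<in>UNIV. model_triangle $ k) = 0"
  by (simp add: sum_3 model_triangle_coordinates complex_eq_iff)

lemma norm_model_triangle: "norm model_triangle = 1"
proof -
  have "(norm model_triangle)\<^sup>2 = 1"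
    by (simp add: norm_power2_eq_sum sum_3 model_triangle_coordinates cmod_power2
        power_divide power_mult_distrib)
  then show ?thesis
    by (simp add: power2_eq_1_iff) (smt (verit) norm_ge_zero)
qed

lemma dispersion_triangle: "dispersion z = (side_u z)\<^sup>2" for z :: "complex ^ 3"
  unfolding dispersion_def side_u_power2 centroid_def sum_3 cmod_power2
  by (simp add: field_simps power2_eq_square)

text \<open>The summand \<open>(side_u z)\<^sup>2 / 2\<close> is the average of \<open>(cmod C)\<^sup>2\<close> over \<open>z\<close> and its mirror image,
  and the area term, which changes sign under reflection, is the difference from that average.\<close>

lemma hermitian_product_model_triangle:
  "(cmod (hermitian_product z model_triangle))\<^sup>2 =
     (side_u z)\<^sup>2 / 2 + twice_signed_area z / sqrt 3"
proof -
  \<comment> \<open>In terms of \<open>t\<close> the claim is a polynomial identity modulo \<open>t\<^sup>2 = 1 / 3\<close>: the part even in \<open>t\<close>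
    gives the side lengths and the part odd in \<open>t\<close> gives the area.\<close>
  define t where "t = 1 / sqrt 3"
  have t: "t\<^sup>2 = 1 / 3"
    by (simp add: t_def power_divide)
  define A B A' B' where "A = 2 * Re (z $ 1) - Re (z $ 2) - Re (z $ 3)"
    and "B = Im (z $ 2) - Im (z $ 3)"
    and "A' = 2 * Im (z $ 1) - Im (z $ 2) - Im (z $ 3)"
    and "B' = Re (z $ 2) - Re (z $ 3)"
  note ABs = A_def B_def A'_def B'_def
  have Re: "Re (hermitian_product z model_triangle) = (t * A + B) / 2"
    and Im: "Im (hermitian_product z model_triangle) = (t * A' - B') / 2"
    by (simp_all add: hermitian_product_def sum_3 model_triangle_coordinates t_def ABs
        diff_divide_distrib add_divide_distrib algebra_simps)
  have "(cmod (hermitian_product z model_triangle))\<^sup>2 =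
      (t\<^sup>2 * (A\<^sup>2 + A'\<^sup>2) + B\<^sup>2 + B'\<^sup>2) / 4 + t * ((A * B - A' * B') / 2)"
    unfolding cmod_power2 Re Im by (simp add: field_simps power2_eq_square)
  also have "(t\<^sup>2 * (A\<^sup>2 + A'\<^sup>2) + B\<^sup>2 + B'\<^sup>2) / 4 = (side_u z)\<^sup>2 / 2"
    unfolding t side_u_power2 cmod_power2 ABs by (simp add: field_simps power2_eq_square)
  also have "(A * B - A' * B') / 2 = twice_signed_area z"
    unfolding twice_signed_area_def ABs by (simp add: field_simps)
  finally show ?thesis
    by (simp add: t_def)
qed

lemma hermitian_product_shape:
  "2 * (cmod (hermitian_product z model_triangle))\<^sup>2 =
     (side_u z)\<^sup>2 * (1 + orientation_sign z * sqrt (3 - 6 * shape_q z))"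
  unfolding hermitian_product_model_triangle distrib_left orientation_times_shape by simp

theorem theorem8:
  fixes z :: "complex ^ 3"
  shows "isometric_deviation z model_triangle =
           sqrt (1 + (side_u z)^2
                 - sqrt 2 * side_u z * sqrt (1 + orientation_sign z * sqrt (3 - 6 * shape_q z)))
       \<and> (\<not> singular_triangle z \<longrightarrow>
            affine_deviation z model_triangle =
              sqrt (1 / 2 * (1 - orientation_sign z * sqrt (3 - 6 * shape_q z))))
       \<and> (singular_triangle z \<longrightarrow> affine_deviation z model_triangle = 1)"
proof (intro conjI impI)
  define C where "C = cmod (hermitian_product z model_triangle)"
  define g where "g = orientation_sign z * sqrt (3 - 6 * shape_q z)"
  have C: "2 * C\<^sup>2 = (side_u z)\<^sup>2 * (1 + g)"
    using hermitian_product_shape by (simp add: C_def g_def)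
  have u: "side_u z \<ge> 0"
    by (simp add: side_u_def)
  have "2 * C = sqrt (2 * (2 * C\<^sup>2))"
    by (simp add: C_def real_sqrt_mult)
  also have "\<dots> = sqrt 2 * side_u z * sqrt (1 + g)"
    unfolding C using u by (simp add: real_sqrt_mult)
  finally show "isometric_deviation z model_triangle =
      sqrt (1 + (side_u z)^2
            - sqrt 2 * side_u z * sqrt (1 + orientation_sign z * sqrt (3 - 6 * shape_q z)))"
    using isometric_deviation_centred[OF model_triangle_centred, of z]
    by (simp add: norm_model_triangle dispersion_triangle C_def g_def algebra_simps)
  show "affine_deviation z model_triangle =
      sqrt (1 / 2 * (1 - orientation_sign z * sqrt (3 - 6 * shape_q z)))"
    if "\<not> singular_triangle z"
  proof -
    have pos: "(side_u z)\<^sup>2 > 0"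
      using that side_u_eq_0_iff[of z] by simp
    then have "1 - C\<^sup>2 / (side_u z)\<^sup>2 = 1 / 2 * (1 - g)"
      using C by (simp add: field_simps)
    then show ?thesis
      using affine_deviation_centred[OF model_triangle_centred, of z] pos
      by (simp add: norm_model_triangle dispersion_triangle C_def g_def)
  qed
  show "affine_deviation z model_triangle = 1" if "singular_triangle z"
  proof -
    have "z $ k = z $ 1" for k
      using that exhaust_3[of k] by (auto simp: singular_triangle_def)
    then show ?thesis
      using affine_deviation_constant[OF model_triangle_centred] norm_model_triangle by metis
  qed
qed

end
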